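(* Let $\alpha>-5/6$. For all $m,n\ge0$ there exist constants $d_{m,n,p,\alpha}$, $0\le p\le\min(m,n)$, such that $$P^{(\alpha)}_{m,n}=\sum_{p=0}^{\min(m,n)}d_{m,n,p,\alpha}\,P^{(\alpha)}_{m-p,0}\,P^{(\alpha)}_{0,n-p}.$$
   Context: $Z,\bar Z$ are treated as two independent variables (conjugate complex coordinates). With $\lambda=\frac12(6\alpha+5)$, the polynomials $P_{p,q}=P^{(\alpha)}_{p,q}(Z,\bar Z)$, $p,q\ge0$, are defined inductively by $P_{0,0}=1$, $P_{0,1}=\bar Z$, $P_{1,0}=Z$ and $$P_{p+1,q}=Z P_{p,q}+a_1(\lambda,p)P_{p-1,q+1}+a_2(\lambda,p,q)P_{p,q-1},\quad P_{p,q+1}=\bar Z P_{p,q}+a_1(\lambda,q)P_{p+1,q-1}+a_2(\lambda,q,p)P_{p-1,q},$$ where $$a_1(\lambda,p)=-\frac{p(3p+2\lambda-5)}{(\lambda+3p-1)(\lambda+3p-4)},\quad a_2(\lambda,p,q)=-\frac{q(3q+2\lambda-5)(\lambda+3(p+q)-1)(\lambda+p+q-2)}{(\lambda+3q-1)(2\lambda+3(p+q)-5)(2\lambda+3(p+q)-2)(\lambda+3q-4)},$$ with $a_1(\lambda,0)=a_2(\lambda,p,0)=0$ and, when a denominator vanishes, the value being the limit as $\epsilon\to0$ of the same expression at $\lambda+\epsilon$. These polynomials are of the form $Z^p\bar Z^q+$ lower degree terms and are eigenvectors, with eigenvalue $-[(\lambda-1)(p+q)+p^2+q^2+pq]$,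 of $L^{(\alpha)}=(\bar Z-Z^2)\partial_Z^2+(1-Z\bar Z)\partial_Z\partial_{\bar Z}+(Z-\bar Z^2)\partial_{\bar Z}^2-\lambda(Z\partial_Z+\bar Z\partial_{\bar Z})$. *)

theory Defs
  imports Complex_Main "HOL-Computational_Algebra.Polynomial"
begin

definition lam :: "real \<Rightarrow> real" where
  "lam \<alpha> = (6 * \<alpha> + 5) / 2"

definition a1_num :: "real \<Rightarrow> nat \<Rightarrow> real" where
  "a1_num l p = real p * (3 * real p + 2 * l - 5)"

definition a1_den :: "real \<Rightarrow> nat \<Rightarrow> real" where
  "a1_den l p = (l + 3 * real p - 1) * (l + 3 * real p - 4)"

definition a1 :: "real \<Rightarrow> nat \<Rightarrow> real" where
  "a1 l p =
    (if p = 0 then 0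
     else if a1_den l p = 0 then Lim (at 0) (\<lambda>\<epsilon>. - a1_num (l + \<epsilon>) p / a1_den (l + \<epsilon>) p)
     else - a1_num l p / a1_den l p)"

definition a2_num :: "real \<Rightarrow> nat \<Rightarrow> nat \<Rightarrow> real" where
  "a2_num l p q =
    real q * (3 * real q + 2 * l - 5) * (l + 3 * real (p + q) - 1) * (l + real (p + q) - 2)"

definition a2_den :: "real \<Rightarrow> nat \<Rightarrow> nat \<Rightarrow> real" where
  "a2_den l p q =
    (l + 3 * real q - 1) * (2 * l + 3 * real (p + q) - 5) *
    (2 * l + 3 * real (p + q) - 2) * (l + 3 * real q - 4)"

definition a2 :: "real \<Rightarrow> nat \<Rightarrow> nat \<Rightarrow> real" where
  "a2 l p q =
    (if q = 0 then 0
     else if a2_den l p q = 0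
       then Lim (at 0) (\<lambda>\<epsilon>. - a2_num (l + \<epsilon>) p q / a2_den (l + \<epsilon>) p q)
     else - a2_num l p q / a2_den l p q)"

text \<open>
  Polynomials in the two independent variables Z and Zbar are modelled as polynomials in Zbar
  whose coefficients are real polynomials in Z.  A real constant c is the polynomial [:[:c:]:].
\<close>

definition Zv :: "real poly poly" where "Zv = [:[:0, 1:]:]"

definition Zbarv :: "real poly poly" where "Zbarv = [:0, 1:]"

definition cst :: "real \<Rightarrow> real poly poly" where "cst c = [:[:c:]:]"

text \<open>
  The two recurrences overlap for p, q > 0.  The recursion below uses the first one to
  raise the first index and the second one only along p = 0; that the resulting family satisfies
  both recurrences for all p, q (whenever lam is positive) is shown in \<open>P_rec1\<close> and \<open>P_rec2\<close>.
  The conditionals drop the terms with a negative index, whose coefficients vanish by convention.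
\<close>

function P :: "real \<Rightarrow> nat \<Rightarrow> nat \<Rightarrow> real poly poly" where
  "P \<alpha> 0 0 = 1"
| "P \<alpha> 0 (Suc q) =
    Zbarv * P \<alpha> 0 q
    + (if q = 0 then 0 else cst (a1 (lam \<alpha>) q) * P \<alpha> 1 (q - 1))"
| "P \<alpha> (Suc p) q =
    Zv * P \<alpha> p q
    + (if p = 0 then 0 else cst (a1 (lam \<alpha>) p) * P \<alpha> (p - 1) (q + 1))
    + (if q = 0 then 0 else cst (a2 (lam \<alpha>) p q) * P \<alpha> p (q - 1))"
  by pat_completeness auto
termination
  by (relation "measure (\<lambda>(_, p, q). p + q)") auto

lemma P_initial:
  "P \<alpha> 0 0 = 1" "P \<alpha> 0 1 = Zbarv" "P \<alpha> 1 0 = Zv"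
  by simp_all

lemma a1_0 [simp]: "a1 l 0 = 0" and a2_0 [simp]: "a2 l p 0 = 0"
  by (simp_all add: a1_def a2_def)

lemma cst_simps: "cst 0 = 0" "cst (x + y) = cst x + cst y" "cst (x - y) = cst x - cst y"
  "cst (x * y) = cst x * cst y"
  by (simp_all add: cst_def)

lemma P_rec1:
  "P \<alpha> (p + 1) q =
    Zv * P \<alpha> p q + cst (a1 (lam \<alpha>) p) * P \<alpha> (p - 1) (q + 1)
    + cst (a2 (lam \<alpha>) p q) * P \<alpha> p (q - 1)"
  by (simp add: cst_simps)

text \<open>Closed forms of the coefficients for positive parameter.\<close>

lemma a1_Suc_0:
  assumes "l > 0" shows "a1 l (Suc 0) = - 2 / (l + 2)"
proof (cases "l = 1")
  case True
  have "((\<lambda>\<epsilon>::real. - 2 / (\<epsilon> + 3)) \<longlongrightarrow> - 2 / (0 + 3)) (at 0)"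
    by (intro tendsto_intros) auto
  then have "((\<lambda>\<epsilon>. - a1_num (l + \<epsilon>) 1 / a1_den (l + \<epsilon>) 1) \<longlongrightarrow> - 2 / (0 + 3)) (at 0)"
    by (rule Lim_transform_eventually)
      (auto simp: eventually_at_filter True a1_num_def a1_den_def divide_simps)
  then show ?thesis
    by (simp add: a1_def a1_den_def True tendsto_Lim)
next
  case False
  then show ?thesis using assms
    by (simp add: a1_def a1_den_def a1_num_def divide_simps) (simp add: algebra_simps)
qed

lemma a2_Suc_0:
  assumes "l > 0"
  shows "a2 l p (Suc 0) = (if p = 0 then - 1 / (2 * l + 1)
     else - 2 * (l + 3 * real p + 2) * (l + real p - 1) /
       ((l + 2) * (2 * l + 3 * real p - 2) * (2 * l + 3 * real p + 1)))" (is "_ = ?f l")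
proof (cases "l = 1")
  case True
  have nz: "3 * real p \<noteq> 0" "3 * real p + 3 \<noteq> 0" if "p \<noteq> 0" using that by auto
  have "((\<lambda>\<epsilon>. ?f (l + \<epsilon>)) \<longlongrightarrow> ?f (l + 0)) (at 0)"
    by (cases "p = 0") (auto intro!: tendsto_eq_intros simp: True)
  moreover have "eventually (\<lambda>\<epsilon>. ?f (l + \<epsilon>) = - a2_num (l + \<epsilon>) p 1 / a2_den (l + \<epsilon>) p 1) (at 0)"
  proof -
    have "eventually (\<lambda>\<epsilon>::real. \<epsilon> \<in> {-1/2<..<1/2}) (at 0)"
      by (intro eventually_at_in_open') auto
    moreover have "eventually (\<lambda>\<epsilon>::real. \<epsilon> \<noteq> 0) (at 0)"
      by (simp add: eventually_at_filter)
    ultimately show ?thesis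
    proof eventually_elim
      case (elim e)
      show ?case
      proof (cases "p = 0")
        case True
        then show ?thesis using elim \<open>l = 1\<close> by (simp add: a2_num_def a2_den_def divide_simps)
      next
        case False
        then have "real p \<ge> 1" by simp
        then have "3 * real p + 2 * e \<noteq> 0" "3 + 3 * real p + 2 * e \<noteq> 0" "3 + e \<noteq> 0" "e \<noteq> 0"
          using elim by auto
        then show ?thesis using False
          by (simp add: a2_num_def a2_den_def \<open>l = 1\<close> divide_simps) (simp add: algebra_simps)
      qed
    qed
  qed
  ultimately have "((\<lambda>\<epsilon>. - a2_num (l + \<epsilon>) p 1 / a2_den (l + \<epsilon>) p 1) \<longlongrightarrow> ?f (l + 0)) (at 0)"
    by (rule Lim_transform_eventually)
  then show ?thesis
    by (simp add: a2_def a2_den_def True tendsto_Lim)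
next
  case False
  show ?thesis
  proof (cases "p = 0")
    case True
    then show ?thesis using assms False
      by (simp add: a2_def a2_num_def a2_den_def divide_simps)
  next
    case p: False
    then have "real p \<ge> 1" by simp
    then have "2 * l + 3 * real p - 2 \<noteq> 0" "2 * l + 3 * real p + 1 \<noteq> 0" "l + 2 \<noteq> 0" "l - 1 \<noteq> 0"
      using assms False by auto
    then show ?thesis using p
      by (simp add: a2_def a2_num_def a2_den_def divide_simps) (simp add: algebra_simps)
  qed
qed

lemma a1_tendsto:
  assumes "l > 0" shows "((\<lambda>x. a1 x p) \<longlongrightarrow> a1 l p) (at l)"
proof -
  have pos: "eventually (\<lambda>x. x \<in> {0<..}) (at l)"
    using assms by (intro eventually_at_in_open') auto
  consider "p = 0" | "p = Suc 0" | "p \<ge> 2" by linarith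
  then show ?thesis
  proof cases
    case 2
    have "((\<lambda>x. - 2 / (x + 2)) \<longlongrightarrow> - 2 / (l + 2)) (at l)"
      using assms by (intro tendsto_intros) auto
    then have "((\<lambda>x. a1 x p) \<longlongrightarrow> - 2 / (l + 2)) (at l)"
      by (rule Lim_transform_eventually, intro eventually_mono[OF pos]) (simp add: 2 a1_Suc_0)
    then show ?thesis using assms by (simp add: 2 a1_Suc_0)
  next
    case 3
    then have p: "real p \<ge> 2" by simp
    have nz: "a1_den x p \<noteq> 0" if "x > 0" for x
      using that p by (simp add: a1_den_def)
    have "((\<lambda>x. - a1_num x p / a1_den x p) \<longlongrightarrow> - a1_num l p / a1_den l p) (at l)"
      using nz[OF assms] unfolding a1_num_def a1_den_def by (intro tendsto_intros) auto
    then have "((\<lambda>x. a1 x p) \<longlongrightarrow> - a1_num l p / a1_den l p) (at l)"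
      by (rule Lim_transform_eventually, intro eventually_mono[OF pos])
        (use 3 nz in \<open>simp add: a1_def\<close>)
    then show ?thesis using assms nz 3 by (simp add: a1_def)
  qed simp
qed

lemma a2_tendsto:
  assumes "l > 0" shows "((\<lambda>x. a2 x p q) \<longlongrightarrow> a2 l p q) (at l)"
proof -
  have pos: "eventually (\<lambda>x. x \<in> {0<..}) (at l)"
    using assms by (intro eventually_at_in_open') auto
  consider "q = 0" | "q = Suc 0" | "q \<ge> 2" by linarith
  then show ?thesis
  proof cases
    case 2
    define f where "f = (\<lambda>x. if p = 0 then - 1 / (2 * x + 1)
     else - 2 * (x + 3 * real p + 2) * (x + real p - 1) /
       ((x + 2) * (2 * x + 3 * real p - 2) * (2 * x + 3 * real p + 1)))"
    have f: "a2 x p q = f x" if "x > 0" for x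
      using a2_Suc_0[OF that, of p] 2 by (simp add: f_def)
    have "(f \<longlongrightarrow> f l) (at l)"
    proof (cases "p = 0")
      case True
      show ?thesis using assms True unfolding f_def by (auto intro!: tendsto_intros)
    next
      case False
      then have "real p \<ge> 1" by simp
      then have "2 * l + 3 * real p - 2 \<noteq> 0" "2 * l + 3 * real p + 1 \<noteq> 0" "l + 2 \<noteq> 0"
        using assms by auto
      then show ?thesis using False unfolding f_def by (auto intro!: tendsto_intros)
    qed
    then have "((\<lambda>x. a2 x p q) \<longlongrightarrow> f l) (at l)"
      by (rule Lim_transform_eventually, intro eventually_mono[OF pos]) (simp add: f)
    then show ?thesis using assms by (simp add: f)
  next
    case 3
    then have q: "real q \<ge> 2" by simp
    have nz: "a2_den x p q \<noteq> 0" if "x > 0" for x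
      using that q by (simp add: a2_den_def)
    have "((\<lambda>x. - a2_num x p q / a2_den x p q) \<longlongrightarrow> - a2_num l p q / a2_den l p q) (at l)"
      using nz[OF assms] unfolding a2_num_def a2_den_def by (intro tendsto_intros) auto
    then have "((\<lambda>x. a2 x p q) \<longlongrightarrow> - a2_num l p q / a2_den l p q) (at l)"
      by (rule Lim_transform_eventually, intro eventually_mono[OF pos])
        (use 3 nz in \<open>simp add: a2_def\<close>)
    then show ?thesis using assms nz 3 by (simp add: a2_def)
  qed simp
qed

text \<open>Away from the exceptional values, both coefficients factor through one rational function.\<close>

definition Rf :: "real \<Rightarrow> real \<Rightarrow> real" where
  "Rf l x = 1 + (1 - l) * (l - 4) / (x * (x - 3))"

definition generic :: "real \<Rightarrow> bool" where
  "generic l \<longleftrightarrow> l > 0 \<and> l \<noteq> 1 \<and> l \<noteq> 4 \<and> 2 * l \<noteq> 5"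

lemma eventually_generic:
  assumes "l > 0" shows "eventually generic (at l)"
proof -
  have "eventually (\<lambda>x. x \<in> {0<..}) (at l)"
    using assms by (intro eventually_at_in_open') auto
  moreover have "eventually (\<lambda>x. x \<noteq> c) (at l)" for c
  proof (cases "c = l")
    case False
    then show ?thesis by (intro tendsto_imp_eventually_ne[OF tendsto_ident_at]) auto
  qed (simp add: eventually_at_filter)
  note this[of 1] this[of 4] this[of "5/2"]
  ultimately show ?thesis
    by eventually_elim (auto simp: generic_def)
qed

lemma generic_nz:
  assumes "generic l"
  shows "l + 3 * real p - 1 \<noteq> 0" "l + 3 * real p - 4 \<noteq> 0"
    "2 * l + 3 * real p - 2 \<noteq> 0" "2 * l + 3 * real p - 5 \<noteq> 0"
proof -
  consider "p = 0" | "p = 1" | "real p \<ge> 2" by linarith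
  then have "l + 3 * real p - 1 \<noteq> 0 \<and> l + 3 * real p - 4 \<noteq> 0 \<and>
    2 * l + 3 * real p - 2 \<noteq> 0 \<and> 2 * l + 3 * real p - 5 \<noteq> 0"
    using assms unfolding generic_def by cases auto
  then show "l + 3 * real p - 1 \<noteq> 0" "l + 3 * real p - 4 \<noteq> 0"
    "2 * l + 3 * real p - 2 \<noteq> 0" "2 * l + 3 * real p - 5 \<noteq> 0" by auto
qed

lemma Rf_alt: 
  assumes "x \<noteq> 0" "x \<noteq> 3" 
  shows "Rf l x = (x + 1 - l) * (x + l - 4) / (x * (x - 3))"
  using assms by (simp add: Rf_def divide_simps) (simp add: algebra_simps)

lemma a1_Rf:
  assumes "generic l" shows "a1 l p = - Rf l (l + 3 * real p - 1) / 3"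
proof -
  define x where "x = l + 3 * real p - 1"
  have nz: "x \<noteq> 0" "x \<noteq> 3" using generic_nz[OF assms, of p] by (auto simp: x_def)
  have den: "a1_den l p = x * (x - 3)" by (simp add: a1_den_def x_def)
  have num: "a1_num l p = (x + 1 - l) * (x + l - 4) / 3"
    by (simp add: a1_num_def x_def field_simps)
  have "a1 l p = - a1_num l p / a1_den l p"
    using nz by (cases "p = 0") (auto simp: a1_def den a1_num_def)
  then show ?thesis unfolding x_def[symmetric] Rf_alt[OF nz] den num by simp
qed

lemma a2_Rf:
  assumes "generic l"
  shows "a2 l p q = Rf l (l + 3 * real q - 1) * Rf l (2 * l + 3 * real (p + q) - 2) * (- 1 / 9)"
proof -
  define x where "x = l + 3 * real q - 1"
  define s where "s = 2 * l + 3 * real (p + q) - 2"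
  have nz: "x \<noteq> 0" "x \<noteq> 3" using generic_nz[OF assms, of q] by (auto simp: x_def)
  have nz': "s \<noteq> 0" "s \<noteq> 3" using generic_nz[OF assms, of "p + q"] by (auto simp: s_def)
  have den: "a2_den l p q = x * (x - 3) * (s * (s - 3))" by (simp add: a2_den_def x_def s_def)
  have num: "a2_num l p q = (x + 1 - l) * (x + l - 4) * ((s + 1 - l) * (s + l - 4)) / 9"
    by (simp add: a2_num_def x_def s_def) (simp add: field_simps)
  have "a2 l p q = - a2_num l p q / a2_den l p q"
    using nz nz' by (cases "q = 0") (auto simp: a2_def den a2_num_def)
  then show ?thesis unfolding x_def[symmetric] s_def[symmetric] Rf_alt[OF nz] Rf_alt[OF nz'] den num
    by simp
qed

lemma extend_by_continuity:
  fixes F :: "real \<Rightarrow> real"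
  assumes "l > 0" "(F \<longlongrightarrow> F l) (at l)" "\<And>x. generic x \<Longrightarrow> F x = 0"
  shows "F l = 0"
proof -
  have "(F \<longlongrightarrow> 0) (at l)"
    by (rule Lim_transform_eventually[OF tendsto_const], 
        rule eventually_mono[OF eventually_generic[OF assms(1)]]) (simp add: assms(3))
  then show ?thesis using assms(2) tendsto_unique[of "at l"] by auto
qed

lemma coeff_id1:
  assumes "l > 0"
  shows "a2 l q p - a2 l p q + a1 l p * a1 l (Suc q) - a1 l q * a1 l (Suc p)
    + a2 l p (Suc q) - a2 l q (Suc p) = 0"
proof (rule extend_by_continuity[OF assms])
  fix l assume g: "generic l"
  define x where "x = l + 3 * real q - 1"
  define y where "y = l + 3 * real p - 1"
  have nzx: "x \<noteq> 0" "x \<noteq> 3" using generic_nz(1,2)[OF g, of q] by (auto simp: x_def)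
  have nzy: "y \<noteq> 0" "y \<noteq> 3" using generic_nz(1,2)[OF g, of p] by (auto simp: y_def)
  have nzx': "x + 3 \<noteq> 0" using generic_nz(1)[OF g, of "Suc q"] by (auto simp: x_def)
  have nzy': "y + 3 \<noteq> 0" using generic_nz(1)[OF g, of "Suc p"] by (auto simp: y_def)
  have eq: "x + y = 2 * l + 3 * real (p + q) - 2"
    "x + y + 3 = 2 * l + 3 * real (Suc (p + q)) - 2" by (auto simp: x_def y_def)
  have nzs: "x + y \<noteq> 0" "x + y + 3 \<noteq> 0" 
    using generic_nz(3)[OF g, of "p + q"] generic_nz(3)[OF g, of "Suc (p + q)"]
    unfolding eq(1)[symmetric] eq(2)[symmetric] by blast+
  have nzs': "x + y \<noteq> 3" using generic_nz(4)[OF g, of "p + q"] by (simp add: eq)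
  note nz = nzx nzy nzx' nzy' nzs nzs'
  define c where "c = (1 - l) * (l - 4)"
  define G where "G = (\<lambda>x::real. 1 / (x * (x - 3)))"
  have R: "Rf l = (\<lambda>x. 1 + c * G x)" by (auto simp: Rf_def c_def G_def)
  have quad: "(G x - G y) * G (x + y) + G y * G (x + 3) - G x * G (y + 3) 
      + (G (y + 3) - G (x + 3)) * G (x + y + 3) = 0"
    using nz by (simp add: G_def divide_simps) algebra
  have *: "(1 + c * G x) * (1 + c * G (x + y)) - (1 + c * G y) * (1 + c * G (x + y))
      + (1 + c * G y) * (1 + c * G (x + 3)) - (1 + c * G x) * (1 + c * G (y + 3))
      - (1 + c * G (x + 3)) * (1 + c * G (x + y + 3))
      + (1 + c * G (y + 3)) * (1 + c * G (x + y + 3)) = 0"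
    using quad by algebra
  have arg: "l + 3 * real (Suc q) - 1 = x + 3" "l + 3 * real (Suc p) - 1 = y + 3"
    "2 * l + 3 * real (p + q) - 2 = x + y" "2 * l + 3 * real (q + p) - 2 = x + y"
    "2 * l + 3 * real (p + Suc q) - 2 = x + y + 3" "2 * l + 3 * real (q + Suc p) - 2 = x + y + 3"
    by (auto simp: x_def y_def)
  show "a2 l q p - a2 l p q + a1 l p * a1 l (Suc q) - a1 l q * a1 l (Suc p)
    + a2 l p (Suc q) - a2 l q (Suc p) = 0"
    unfolding a1_Rf[OF g] a2_Rf[OF g] arg x_def[symmetric] y_def[symmetric] R
    using * by (simp add: field_simps)
qed (intro tendsto_intros a1_tendsto a2_tendsto assms)

lemma coeff_id2:
  assumes "l > 0"
  shows "a1 l (Suc p) * a2 l (Suc q) p - a2 l q (Suc p) * a1 l p = 0"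
  by (rule extend_by_continuity[OF assms], intro tendsto_intros a1_tendsto a2_tendsto assms)
    (simp add: a1_Rf a2_Rf)

lemma coeff_id3:
  assumes "l > 0"
  shows "a2 l (Suc q) (Suc p) * a2 l p (Suc q) - a2 l (Suc p) (Suc q) * a2 l q (Suc p) = 0"
  by (rule extend_by_continuity[OF assms], intro tendsto_intros a1_tendsto a2_tendsto assms)
    (simp add: a1_Rf a2_Rf add.commute)

lemma P_rec2:
  assumes "lam \<alpha> > 0"
  shows "P \<alpha> p (q + 1) =
    Zbarv * P \<alpha> p q + cst (a1 (lam \<alpha>) q) * P \<alpha> (p + 1) (q - 1)
    + cst (a2 (lam \<alpha>) q p) * P \<alpha> (p - 1) q"
proof (induction "p + q" arbitrary: p q rule: less_induct)
  case less
  define l where "l = lam \<alpha>"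
  have r1: "P \<alpha> (Suc p) q = Zv * P \<alpha> p q + cst (a1 l p) * P \<alpha> (p - 1) (Suc q)
    + cst (a2 l p q) * P \<alpha> p (q - 1)" for p q
    using P_rec1[of \<alpha> p q] by (simp add: l_def)
  have IH: "P \<alpha> p' (Suc q') = Zbarv * P \<alpha> p' q' + cst (a1 l q') * P \<alpha> (Suc p') (q' - 1)
    + cst (a2 l q' p') * P \<alpha> (p' - 1) q'" if "p' + q' < p + q" for p' q'
    using less[OF that] by (simp add: l_def)
  have l: "l > 0" using assms by (simp add: l_def)
  show ?case
  proof (cases p)
    case 0
    then show ?thesis by (simp add: cst_simps)
  next
    case (Suc n)
    have e1: "cst (a2 l q n) - cst (a2 l n q) + cst (a1 l n) * cst (a1 l (Suc q))
      - cst (a1 l q) * cst (a1 l (Suc n)) + cst (a2 l n (Suc q)) - cst (a2 l q (Suc n)) = 0"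
      using arg_cong[OF coeff_id1[OF l, of q n], of cst] by (simp add: cst_simps)
    have s1: "P \<alpha> (Suc n) (Suc q) = Zv * P \<alpha> n (Suc q) + cst (a1 l n) * P \<alpha> (n - 1) (Suc (Suc q))
       + cst (a2 l n (Suc q)) * P \<alpha> n q" using r1[of n "Suc q"] by simp
    have s2: "P \<alpha> n (Suc q) = Zbarv * P \<alpha> n q + cst (a1 l q) * P \<alpha> (Suc n) (q - 1)
       + cst (a2 l q n) * P \<alpha> (n - 1) q" by (rule IH) (simp add: Suc)
    have s3: "cst (a1 l n) * P \<alpha> (n - 1) (Suc (Suc q)) = cst (a1 l n) * (Zbarv * P \<alpha> (n - 1) (Suc q)
      + cst (a1 l (Suc q)) * P \<alpha> n q + cst (a2 l (Suc q) (n - 1)) * P \<alpha> (n - 2) (Suc q))"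
      by (cases n) (use IH[of "n - 1" "Suc q"] in \<open>auto simp: cst_simps Suc numeral_2_eq_2\<close>)
    have s4: "P \<alpha> (Suc n) q = Zv * P \<alpha> n q + cst (a1 l n) * P \<alpha> (n - 1) (Suc q)
      + cst (a2 l n q) * P \<alpha> n (q - 1)" by (rule r1)
    have s5: "cst (a1 l q) * P \<alpha> (Suc (Suc n)) (q - 1) = cst (a1 l q) * (Zv * P \<alpha> (Suc n) (q - 1)
      + cst (a1 l (Suc n)) * P \<alpha> n q + cst (a2 l (Suc n) (q - 1)) * P \<alpha> (Suc n) (q - 2))"
      by (cases q) (simp_all add: cst_simps r1[of "Suc n"] numeral_2_eq_2 del: P.simps)
    have s6: "cst (a2 l q n) * P \<alpha> n q = cst (a2 l q n) * (Zv * P \<alpha> (n - 1) q 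
      + cst (a1 l (n - 1)) * P \<alpha> (n - 2) (Suc q) + cst (a2 l (n - 1) q) * P \<alpha> (n - 1) (q - 1))"
      by (cases n) (simp_all add: cst_simps r1 numeral_2_eq_2 del: P.simps)
    have s7: "cst (a2 l n q) * P \<alpha> n q = cst (a2 l n q) * (Zbarv * P \<alpha> n (q - 1)
      + cst (a1 l (q - 1)) * P \<alpha> (Suc n) (q - 2) + cst (a2 l (q - 1) n) * P \<alpha> (n - 1) (q - 1))"
      by (cases q) (use IH[of n "q - 1"] in \<open>auto simp: cst_simps Suc numeral_2_eq_2\<close>)
    have e2: "cst (a1 l n) * cst (a2 l (Suc q) (n - 1)) = cst (a2 l q n) * cst (a1 l (n - 1))"
      using arg_cong[OF coeff_id2[OF l, of "n - 1" q], of cst]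
      by (cases n) (auto simp: cst_simps)
    have e2': "cst (a1 l q) * cst (a2 l (Suc n) (q - 1)) = cst (a2 l n q) * cst (a1 l (q - 1))"
      using arg_cong[OF coeff_id2[OF l, of "q - 1" n], of cst]
      by (cases q) (auto simp: cst_simps)
    have e3: "cst (a2 l q n) * cst (a2 l (n - 1) q) = cst (a2 l n q) * cst (a2 l (q - 1) n)"
      using arg_cong[OF coeff_id3[OF l, of "q - 1" "n - 1"], of cst]
      by (cases n; cases q) (auto simp: cst_simps)
    have "P \<alpha> (Suc n) (Suc q) = Zbarv * P \<alpha> (Suc n) q + cst (a1 l q) * P \<alpha> (Suc (Suc n)) (q - 1)
      + cst (a2 l q (Suc n)) * P \<alpha> n q"
      unfolding s5 s1 s3 s2 s4
      using s6 s7 e1 e2 e2' e3 by algebra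
    then show ?thesis by (simp add: Suc l_def)
  qed
qed

end

theory Submission
  imports Defs
begin

text \<open>
  The idea is to prove the Pieri formula
  \<open>P m 0 * P 0 n = (\<Sum>p. c m n p * P (m - p) (n - p))\<close> with \<open>c m n 0 = 1\<close> and to invert this triangular
  relation. Multiplying out \<open>P (m + 1) 0 = Z P m 0 + a1 m (Zbar P (m - 1) 0 + a2 0 (m - 1) P (m - 2) 0)\<close>
  by \<open>P 0 n\<close> and using the two recurrences yields terms \<open>P a b\<close> with \<open>a - b = m + 1 - n\<close>, which define \<open>c\<close>
  recursively, and terms with \<open>a - b = m - 2 - n\<close>, which have to cancel. For generic parameter
  \<open>lam = 3 k + 1\<close> the coefficients are the Jack polynomial Pieri coefficients of type A2, explicit
  quotients of Pochhammer symbols, and the cancellation becomes a rational identity. It extends to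
  all positive parameters by continuity, since \<open>a1\<close>, \<open>a2\<close> and hence \<open>c\<close> are continuous there.
\<close>

subsection \<open>Closed form of the Pieri coefficients\<close>

text \<open>The descending factorial a (a - 1) ... (a - p + 1) with a real argument.\<close>

definition falling :: "real \<Rightarrow> nat \<Rightarrow> real" where
  "falling a p = pochhammer (a - real p + 1) p"

text \<open>The product of the \<open>p\<close> consecutive factors z - 2 p, ..., z - p - 1. Its
  starting point moves by two when \<open>p\<close> grows by one, as does the total degree of
  \<open>P (m - p) (n - p)\<close>.\<close>

definition central :: "real \<Rightarrow> nat \<Rightarrow> real" where
  "central z p = pochhammer (z - 2 * real p) p"

lemma falling_0 [simp]: "falling a 0 = 1" and central_0 [simp]: "central a 0 = 1"
  by (simp_all add: falling_def central_def)

lemma falling_add1_Suc: "falling (a + 1) (Suc p) = (a + 1) * falling a p"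
  by (simp add: falling_def pochhammer_Suc algebra_simps)

lemma falling_Suc: "falling a (Suc p) = (a - real p) * falling a p"
  by (simp add: falling_def pochhammer_rec algebra_simps)

text \<open>Both sides equal \<open>falling a (Suc p)\<close>, with the first or the last factor
  split off.\<close>

lemma falling_diff1: "a * falling (a - 1) p = (a - real p) * falling a p"
  using falling_add1_Suc[of "a - 1" p] falling_Suc[of a p] by simp

lemma central_add1_Suc: "central (z + 1) (Suc p) = (z - 2 * real p - 1) * central z p"
  by (simp add: central_def pochhammer_rec algebra_simps)

text \<open>Both sides are one product of p + 1 consecutive factors, with the last or the first
  factor split off.\<close>

lemma central_diff1: "(z - real p - 1) * central (z - 1) p = (z - 2 * real p - 1) * central z p"
proof -
  have "pochhammer (z - 2 * real p - 1) (Suc p) = (z - 2 * real p - 1) * central z p"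
    by (simp add: central_def pochhammer_rec)
  moreover have "pochhammer (z - 2 * real p - 1) (Suc p) = (z - real p - 1) * central (z - 1) p"
    by (simp add: central_def pochhammer_Suc algebra_simps)
  ultimately show ?thesis by simp
qed

lemma central_Suc:
  "(z - real p - 1) * central z (Suc p) = (z - 2 * real p - 2) * (z - 2 * real p - 1) * central z p"
proof -
  have "central z (Suc p) = (z - 2 * real p - 2) * central (z - 1) p"
    using central_add1_Suc[of "z - 1" p] by (simp add: algebra_simps)
  then show ?thesis
    using central_diff1[of z p] by algebra
qed

lemma falling_of_nat_eq_0: "m < p \<Longrightarrow> falling (real m) p = 0"
proof (induction p)
  case (Suc p)
  then show ?case by (cases "m = p") (auto simp: falling_Suc)
qed simp

text \<open>The indices \<open>m\<close>, \<open>n\<close> are real, so that shifts such as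
  \<open>m - 1\<close> are not truncated. The power of 9 matches the factors 1/3 in
  \<open>a1\<close> and 1/9 in \<open>a2\<close>.\<close>

definition pieri_closed :: "real \<Rightarrow> real \<Rightarrow> real \<Rightarrow> nat \<Rightarrow> real" where
  "pieri_closed k m n p = pochhammer k p / fact p * (falling m p * falling n p * central (m + n + 3 * k) p) /
     (falling (m + k - 1) p * falling (n + k - 1) p * central (m + n + 2 * k + 1) p * 9 ^ p)"

lemma pieri_closed_0 [simp]: "pieri_closed k m n 0 = 1"
  by (simp add: pieri_closed_def)

lemma pieri_closed_eq_0:
  assumes "m < p \<or> n < p" shows "pieri_closed k (real m) (real n) p = 0"
  using assms by (auto simp: pieri_closed_def falling_of_nat_eq_0)

section \<open>Contiguous relations of the closed form\<close>

lemma pieri_closed_add1_Suc: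
  "pieri_closed k (m + 1) n (Suc p) = pieri_closed k m n p *
     ((k + real p) * (m + 1) * (n - real p) * (m + n + 3 * k - 2 * real p - 1) /
      ((real p + 1) * (m + k) * (n + k - 1 - real p) * (m + n + 2 * k - 2 * real p) * 9))"
proof -
  have f: "falling (m + 1 + k - 1) (Suc p) = (m + k) * falling (m + k - 1) p"
    using falling_add1_Suc[of "m + k - 1" p] by simp
  have g1: "central (m + 1 + n + 3 * k) (Suc p) = (m + n + 3 * k - 2 * real p - 1) * central (m + n + 3 * k) p"
    using central_add1_Suc[of "m + n + 3 * k" p] by (simp add: algebra_simps)
  have g2: "central (m + 1 + n + 2 * k + 1) (Suc p) = (m + n + 2 * k - 2 * real p) * central (m + n + 2 * k + 1) p"
    using central_add1_Suc[of "m + n + 2 * k + 1" p] by (simp add: algebra_simps)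
  show ?thesis
    unfolding pieri_closed_def f g1 g2 falling_add1_Suc falling_Suc[of n] falling_Suc[of "n + k - 1"] pochhammer_Suc
    by (simp add: mult_ac add.commute)
qed

text \<open>Raising \<open>p\<close> alone moves the starting point of \<open>central\<close>, which
  by \<open>central_Suc\<close> brings in two factors and removes one; the removed factors are those
  assumed nonzero. In \<open>pieri_closed_add1_Suc\<close>, where \<open>m\<close> rises too,
  factors are only brought in.\<close>

lemma pieri_closed_Suc:
  assumes "m + n + 3 * k - real p - 1 \<noteq> 0" "m + n + 2 * k - real p \<noteq> 0"
  shows "pieri_closed k m n (Suc p) = pieri_closed k m n p *
     ((k + real p) * (m - real p) * (n - real p) *
      (m + n + 3 * k - 2 * real p - 2) * (m + n + 3 * k - 2 * real p - 1) * (m + n + 2 * k - real p) /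
      ((real p + 1) * (m + k - 1 - real p) * (n + k - 1 - real p) * (m + n + 3 * k - real p - 1) *
       (m + n + 2 * k - 2 * real p - 1) * (m + n + 2 * k - 2 * real p) * 9))"
proof -
  have g1: "central (m + n + 3 * k) (Suc p) = (m + n + 3 * k - 2 * real p - 2) *
      (m + n + 3 * k - 2 * real p - 1) * central (m + n + 3 * k) p / (m + n + 3 * k - real p - 1)"
    using central_Suc[of "m + n + 3 * k" p] assms by (simp add: field_simps)
  have g2: "central (m + n + 2 * k + 1) (Suc p) = (m + n + 2 * k - 2 * real p - 1) *
      (m + n + 2 * k - 2 * real p) * central (m + n + 2 * k + 1) p / (m + n + 2 * k - real p)"
    using central_Suc[of "m + n + 2 * k + 1" p] assms by (simp add: field_simps)
  show ?thesis
    unfolding pieri_closed_def g1 g2 falling_Suc pochhammer_Suc by (simp add: mult_ac add.commute)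
qed

lemma pieri_closed_diff1:
  assumes "m \<noteq> 0" "m + k - 1 \<noteq> 0" "m + k - 1 - real p \<noteq> 0"
    "m + n + 3 * k - real p - 1 \<noteq> 0" "m + n + 2 * k - real p \<noteq> 0"
  shows "pieri_closed k (m - 1) n p = pieri_closed k m n p *
     ((m - real p) * (m + k - 1) * (m + n + 3 * k - 2 * real p - 1) * (m + n + 2 * k - real p) /
      (m * (m + k - 1 - real p) * (m + n + 3 * k - real p - 1) * (m + n + 2 * k - 2 * real p)))"
proof -
  have g1: "central (m - 1 + n + 3 * k) p = (m + n + 3 * k - 2 * real p - 1) * central (m + n + 3 * k) p /
      (m + n + 3 * k - real p - 1)"
    using central_diff1[of "m + n + 3 * k" p] assms by (simp add: field_simps)
  have g2: "central (m - 1 + n + 2 * k + 1) p = (m + n + 2 * k - 2 * real p) * central (m + n + 2 * k + 1) p /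
      (m + n + 2 * k - real p)"
    using central_diff1[of "m + n + 2 * k + 1" p] assms by (simp add: field_simps)
  have f1: "falling (m - 1) p = (m - real p) * falling m p / m"
    using falling_diff1[of m p] assms by (simp add: field_simps)
  have f2: "falling (m - 1 + k - 1) p = (m + k - 1 - real p) * falling (m + k - 1) p / (m + k - 1)"
  proof -
    have "m - 1 + k - 1 = m + k - 1 - 1" by simp
    then show ?thesis
      using falling_diff1[of "m + k - 1" p] assms(2) by (simp add: field_simps)
  qed
  show ?thesis
    unfolding pieri_closed_def g1 g2 f1 f2 by (simp add: mult_ac)
qed

text \<open>The three contiguous relations in the variables \<open>a = m - p\<close> and
  \<open>b = n - p\<close>, the indices of \<open>P (m - p) (n - p)\<close>. In these the linear
  factors take the same form as those of \<open>a1\<close> and \<open>a2\<close>.\<close>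

lemma pieri_closed_shift:
  fixes a b k :: real and p :: nat
  shows "pieri_closed k (a + real p + 1) (b + real p) (Suc p) =
     pieri_closed k (a + real p) (b + real p) p *
     ((k + real p) * (a + real p + 1) * b * (a + b + 3 * k - 1) /
      ((real p + 1) * (a + real p + k) * (b + k - 1) * (a + b + 2 * k) * 9))"
    "a + b + real p + 3 * k - 1 \<noteq> 0 \<Longrightarrow> a + b + real p + 2 * k \<noteq> 0 \<Longrightarrow>
     pieri_closed k (a + real p) (b + real p) (Suc p) = pieri_closed k (a + real p) (b + real p) p *
     ((k + real p) * a * b * (a + b + 3 * k - 2) * (a + b + 3 * k - 1) * (a + b + real p + 2 * k) /
      ((real p + 1) * (a + k - 1) * (b + k - 1) * (a + b + real p + 3 * k - 1) *
       (a + b + 2 * k - 1) * (a + b + 2 * k) * 9))"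
    "a + real p \<noteq> 0 \<Longrightarrow> a + real p + k - 1 \<noteq> 0 \<Longrightarrow> a + k - 1 \<noteq> 0 \<Longrightarrow>
     a + b + real p + 3 * k - 1 \<noteq> 0 \<Longrightarrow> a + b + real p + 2 * k \<noteq> 0 \<Longrightarrow>
     pieri_closed k (a + real p - 1) (b + real p) p = pieri_closed k (a + real p) (b + real p) p *
     (a * (a + real p + k - 1) * (a + b + 3 * k - 1) * (a + b + real p + 2 * k) /
      ((a + real p) * (a + k - 1) * (a + b + real p + 3 * k - 1) * (a + b + 2 * k)))"
proof -
  define m n where "m = a + real p" "n = b + real p"
  have e: "m - real p = a" "n - real p = b" "m + k - 1 - real p = a + k - 1"
    "n + k - 1 - real p = b + k - 1"
    "m + n + 3 * k - real p - 1 = a + b + real p + 3 * k - 1"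
    "m + n + 2 * k - real p = a + b + real p + 2 * k"
    "m + n + 3 * k - 2 * real p - 2 = a + b + 3 * k - 2"
    "m + n + 3 * k - 2 * real p - 1 = a + b + 3 * k - 1"
    "m + n + 2 * k - 2 * real p - 1 = a + b + 2 * k - 1"
    "m + n + 2 * k - 2 * real p = a + b + 2 * k"
    by (simp_all add: m_n_def)
  show "pieri_closed k (a + real p + 1) (b + real p) (Suc p) =
     pieri_closed k (a + real p) (b + real p) p *
     ((k + real p) * (a + real p + 1) * b * (a + b + 3 * k - 1) /
      ((real p + 1) * (a + real p + k) * (b + k - 1) * (a + b + 2 * k) * 9))"
    using pieri_closed_add1_Suc[of k m n p] unfolding e unfolding m_n_def .
  show "a + b + real p + 3 * k - 1 \<noteq> 0 \<Longrightarrow> a + b + real p + 2 * k \<noteq> 0 \<Longrightarrow>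
     pieri_closed k (a + real p) (b + real p) (Suc p) = pieri_closed k (a + real p) (b + real p) p *
     ((k + real p) * a * b * (a + b + 3 * k - 2) * (a + b + 3 * k - 1) * (a + b + real p + 2 * k) /
      ((real p + 1) * (a + k - 1) * (b + k - 1) * (a + b + real p + 3 * k - 1) *
       (a + b + 2 * k - 1) * (a + b + 2 * k) * 9))"
    using pieri_closed_Suc[of m n k p] unfolding e unfolding m_n_def .
  show "a + real p \<noteq> 0 \<Longrightarrow> a + real p + k - 1 \<noteq> 0 \<Longrightarrow> a + k - 1 \<noteq> 0 \<Longrightarrow>
     a + b + real p + 3 * k - 1 \<noteq> 0 \<Longrightarrow> a + b + real p + 2 * k \<noteq> 0 \<Longrightarrow>
     pieri_closed k (a + real p - 1) (b + real p) p = pieri_closed k (a + real p) (b + real p) p *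
     (a * (a + real p + k - 1) * (a + b + 3 * k - 1) * (a + b + real p + 2 * k) /
      ((a + real p) * (a + k - 1) * (a + b + real p + 3 * k - 1) * (a + b + 2 * k)))"
    using pieri_closed_diff1[of m k p n] unfolding e unfolding m_n_def .
qed

text \<open>The recursion of \<open>pieri\<close> for the closed form, after division by the factor
  common to its four terms, with \<open>a = m - p\<close>, \<open>b = n - p\<close>,
  \<open>q = p\<close>. Clearing denominators leaves a polynomial identity in free
  variables.\<close>

lemma pieri_coeff_identity:
  fixes a b q k :: real
  assumes "a+q+k \<noteq> 0" "q+1\<noteq>0" "a+k-1\<noteq>0" "a+b+q+3*k-1\<noteq>0" "a+b+2*k-1\<noteq>0" "b+k\<noteq>0"
  shows "(a+q+1)*(k+q)/((a+q+k)*(q+1)) = (k+q)*a*(a+b+3*k-2)*(a+b+q+2*k)/((q+1)*(a+k-1)*(a+b+q+3*k-1)*(a+b+2*k-1))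
   + (b+2*k-1)*(a+b+k)/((b+k)*(a+b+2*k-1))
   - (a+q+2*k-1)*(b+2*k-1)*a*(a+b+q+2*k)/((a+q+k)*(b+k)*(a+k-1)*(a+b+q+3*k-1))"
  using assms by (simp add: divide_simps) algebra

text \<open>The cancellation relation for the closed form, reduced in the same way and in the same
  variables.\<close>

lemma pieri_cancel_identity:
  fixes a b q k :: real
  assumes "a+k\<noteq>0" "b+k-1\<noteq>0" "q+1\<noteq>0" "a+q+k+1 \<noteq> 0" "a+b+q+3*k-1\<noteq>0" "a+b+2*k-1\<noteq>0" "a+q+2*k\<noteq>0"
  shows "(a+2*k-1)*b*(k+q)/((a+k)*(b+k-1)*(q+1)) = (a+q+2*k)/(a+q+k+1)*
   ((k+q)*b*(a+b+3*k-2)*(a+b+q+2*k)/((q+1)*(b+k-1)*(a+b+q+3*k-1)*(a+b+2*k-1))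
    + (a+2*k-1)*(a+b+k)/((a+k)*(a+b+2*k-1)) - (a+q+3*k-1)*(a+b+q+2*k)/((a+q+2*k)*(a+b+q+3*k-1)))"
  using assms by (simp add: divide_simps) algebra

subsection \<open>The Pieri coefficients\<close>

lemma a1_generic:
  assumes "generic (3 * k + 1)"
  shows "a1 (3 * k + 1) p = - (real p * (real p + 2 * k - 1)) / (3 * (real p + k) * (real p + k - 1))"
proof (cases "p = 0")
  case False
  have "a1_den (3 * k + 1) p = 9 * ((real p + k) * (real p + k - 1))"
    "a1_num (3 * k + 1) p = 3 * (real p * (real p + 2 * k - 1))"
    by (simp_all add: a1_den_def a1_num_def algebra_simps)
  moreover have "real p + k \<noteq> 0" "real p + k - 1 \<noteq> 0"
    using generic_nz(1,2)[OF assms, of p] by auto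
  ultimately show ?thesis using False by (simp add: a1_def)
qed simp

lemma a2_generic:
  assumes "generic (3 * k + 1)"
  shows "a2 (3 * k + 1) p q =
    - (real q * (real q + 2 * k - 1) * (real p + real q + k) * (real p + real q + 3 * k - 1)) /
      (9 * (real q + k) * (real q + k - 1) * (real p + real q + 2 * k - 1) * (real p + real q + 2 * k))"
proof (cases "q = 0")
  case False
  have e: "a2_den (3 * k + 1) p q = 81 * ((real q + k) * (real q + k - 1) *
      (real p + real q + 2 * k - 1) * (real p + real q + 2 * k))"
    "a2_num (3 * k + 1) p q = 9 * (real q * (real q + 2 * k - 1) * (real p + real q + k) *
      (real p + real q + 3 * k - 1))"
    by (simp_all add: a2_den_def a2_num_def algebra_simps)
  have "real q + k \<noteq> 0" "real q + k - 1 \<noteq> 0"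
    "real p + real q + 2 * k - 1 \<noteq> 0" "real p + real q + 2 * k \<noteq> 0"
    using generic_nz(1,2)[OF assms, of q] generic_nz(3,4)[OF assms, of "p + q"] by auto
  then have "a2 (3 * k + 1) p q = - a2_num (3 * k + 1) p q / a2_den (3 * k + 1) p q"
    using False by (simp add: a2_def e(1))
  moreover have "- (9 * x) / (81 * y) = - x / (9 * y)" for x y :: real by simp
  ultimately show ?thesis
    by (simp only: e mult.assoc)
qed simp

text \<open>The last clause collects the coefficient of \<open>P (m - p) (n - Suc p)\<close> in
  \<open>P (Suc m) 0 * P 0 n\<close>: the terms come from multiplication by \<open>Zv\<close>,
  raising and lowering, and from multiplication by \<open>Zbarv\<close>.\<close>

function pieri :: "real \<Rightarrow> nat \<Rightarrow> nat \<Rightarrow> nat \<Rightarrow> real" where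
  "pieri l m n 0 = 1"
| "pieri l 0 n (Suc p) = 0"
| "pieri l (Suc m) n (Suc p) = pieri l m n (Suc p) - a2 l (m - p) (n - p) * pieri l m n p
     - a1 l m * a1 l (n - p) * pieri l (m - 1) n p"
  by pat_completeness auto
termination
  by (relation "measure (\<lambda>(_, m, _, p). m + p)") auto

text \<open>The boundary case \<open>n = p\<close> of the recursion step holds because
  \<open>a1\<close> and \<open>a2\<close> vanish when the index that is lowered is 0.\<close>

lemma pieri_eq_0: "m < p \<or> n < p \<Longrightarrow> pieri l m n p = 0"
  by (induction l m n p rule: pieri.induct) (auto simp: less_imp_diff_less)

lemma pieri_tendsto: "l > 0 \<Longrightarrow> ((\<lambda>x. pieri x m n p) \<longlongrightarrow> pieri l m n p) (at l)"
  by (induction l m n p rule: pieri.induct)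
    (auto intro!: tendsto_intros a1_tendsto a2_tendsto)

text \<open>Removed from the simpset below: products such as \<open>3 * (A + Q + k)\<close> must
  stay factored for common factors to cancel.\<close>

lemmas numeral_distribs = distrib_left_numeral distrib_right_numeral
  left_diff_distrib_numeral right_diff_distrib_numeral

text \<open>For \<open>p \<ge> 2\<close> all forms are positive since k > -1/3; for
  \<open>p = 0\<close> and \<open>p = 1\<close> the excluded values decide. The last form needs
  \<open>p > 0\<close>, because k = 1/3 is generic.\<close>

lemma generic_k_nz:
  assumes "generic (3 * k + 1)"
  shows "real p + k \<noteq> 0" "real p + k - 1 \<noteq> 0" "real p + 2 * k \<noteq> 0" "real p + 2 * k - 1 \<noteq> 0"
    "p > 0 \<Longrightarrow> real p + 3 * k - 1 \<noteq> 0"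
proof -
  have k: "k > - 1 / 3" "k \<noteq> 0" "k \<noteq> 1" "2 * k \<noteq> 1"
    using assms by (auto simp: generic_def)
  have "p = 0 \<or> p = 1 \<or> real p \<ge> 2" by linarith
  then show "real p + k \<noteq> 0" "real p + k - 1 \<noteq> 0" "real p + 2 * k \<noteq> 0" "real p + 2 * k - 1 \<noteq> 0"
    "p > 0 \<Longrightarrow> real p + 3 * k - 1 \<noteq> 0"
    using k by auto
qed

section \<open>The closed form satisfies the recursion of \<open>pieri\<close>\<close>

lemma pieri_closed_rec_aux:
  fixes k :: real and a b q :: nat
  defines "l \<equiv> 3 * k + 1"
  defines "C \<equiv> \<lambda>m n. pieri_closed k (real m) (real n)"
  assumes g: "generic l" and b: "b > 0"
  shows "C (a + q + 1) (b + q) (Suc q) = C (a + q) (b + q) (Suc q) - a2 l a b * C (a + q) (b + q) q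
      - a1 l (a + q) * a1 l b * C (a + q - 1) (b + q) q"
proof -
  note g = g[unfolded l_def]
  define A B Q where "A = real a" "B = real b" "Q = real q"
  note d = A_B_Q_def
  note numeral_distribs [simp del]
  have nz: "A + Q + k \<noteq> 0" "Q + 1 \<noteq> 0" "A + k - 1 \<noteq> 0" "A + B + Q + 3 * k - 1 \<noteq> 0"
    "A + B + 2 * k - 1 \<noteq> 0" "B + k \<noteq> 0" "A + B + Q + 2 * k \<noteq> 0" "A + Q + k - 1 \<noteq> 0"
    using generic_k_nz(1)[OF g, of "a + q"] generic_k_nz(2)[OF g, of a]
      generic_k_nz(5)[OF g, of "a + b + q"] generic_k_nz(4)[OF g, of "a + b"] generic_k_nz(1)[OF g, of b]
      generic_k_nz(3)[OF g, of "a + b + q"] generic_k_nz(2)[OF g, of "a + q"] b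
    by (auto simp: d)
  define G where "G = pieri_closed k (A + Q) (B + Q) q"
  have 1: "C (a + q + 1) (b + q) (Suc q) = G *
     ((k + Q) * (A + Q + 1) * B * (A + B + 3 * k - 1) /
      ((Q + 1) * (A + Q + k) * (B + k - 1) * (A + B + 2 * k) * 9))"
    using pieri_closed_shift(1)[where a = A and b = B and p = q and k = k] by (simp add: C_def G_def d add_ac)
  have 2: "C (a + q) (b + q) (Suc q) = G *
     ((k + Q) * A * B * (A + B + 3 * k - 2) * (A + B + 3 * k - 1) * (A + B + Q + 2 * k) /
      ((Q + 1) * (A + k - 1) * (B + k - 1) * (A + B + Q + 3 * k - 1) *
       (A + B + 2 * k - 1) * (A + B + 2 * k) * 9))"
    using pieri_closed_shift(2)[where a = A and b = B and p = q and k = k] nz by (simp add: C_def G_def d)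
  have 3: "a1 l (a + q) * C (a + q - 1) (b + q) q = - G * ((A + Q + 2 * k - 1) / (3 * (A + Q + k))) *
     (A * (A + B + 3 * k - 1) * (A + B + Q + 2 * k) /
      ((A + k - 1) * (A + B + Q + 3 * k - 1) * (A + B + 2 * k)))"
  \<comment> \<open>For \<open>a + q = 0\<close> the index \<open>a + q - 1\<close> is truncated,
    but both sides are 0, as \<open>a1 l 0 = 0\<close> and \<open>A = 0\<close>. Otherwise the
    factor \<open>A + Q\<close> of \<open>a1\<close> cancels the denominator of the shift.\<close>
  proof (cases "a + q = 0")
    case False
    have a: "a1 l (a + q) = - ((A + Q) * (A + Q + 2 * k - 1)) / (3 * (A + Q + k) * (A + Q + k - 1))"
      unfolding l_def a1_generic[OF g] by (simp add: d)
    have AQ: "A + Q \<noteq> 0" using False by (auto simp: d)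
    have "C (a + q - 1) (b + q) q = pieri_closed k (A + Q - 1) (B + Q) q"
      using False by (simp add: C_def d of_nat_diff Suc_leI)
    also have "\<dots> = G * (A * (A + Q + k - 1) * (A + B + 3 * k - 1) * (A + B + Q + 2 * k) /
        ((A + Q) * (A + k - 1) * (A + B + Q + 3 * k - 1) * (A + B + 2 * k)))"
      using pieri_closed_shift(3)[where a = A and b = B and p = q and k = k] AQ nz unfolding G_def d by blast
    finally show ?thesis
      unfolding a using nz AQ by (simp add: mult_ac)
  qed (simp add: d)
  have 4: "a1 l b = - (B * (B + 2 * k - 1)) / (3 * (B + k) * (B + k - 1))"
    unfolding l_def a1_generic[OF g] by (simp add: d)
  have 5: "a2 l a b = - (B * (B + 2 * k - 1) * (A + B + k) * (A + B + 3 * k - 1)) /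
      (9 * (B + k) * (B + k - 1) * (A + B + 2 * k - 1) * (A + B + 2 * k))"
    unfolding l_def a2_generic[OF g] by (simp add: d)
  \<comment> \<open>The factor common to all four terms; dividing by it leaves
    \<open>pieri_coeff_identity\<close>.\<close>
  define H where "H = G * B * (A + B + 3 * k - 1) / (9 * (B + k - 1) * (A + B + 2 * k))"
  have "C (a + q + 1) (b + q) (Suc q) = H * ((A+Q+1)*(k+Q)/((A+Q+k)*(Q+1)))"
    unfolding 1 H_def by (simp add: mult_ac)
  also have "\<dots> = H * ((k+Q)*A*(A+B+3*k-2)*(A+B+Q+2*k)/((Q+1)*(A+k-1)*(A+B+Q+3*k-1)*(A+B+2*k-1)))
     + H * ((B+2*k-1)*(A+B+k)/((B+k)*(A+B+2*k-1)))
     - H * ((A+Q+2*k-1)*(B+2*k-1)*A*(A+B+Q+2*k)/((A+Q+k)*(B+k)*(A+k-1)*(A+B+Q+3*k-1)))"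
    unfolding pieri_coeff_identity[OF nz(1-6)] by (simp only: distrib_left right_diff_distrib)
  also have "H * ((k+Q)*A*(A+B+3*k-2)*(A+B+Q+2*k)/((Q+1)*(A+k-1)*(A+B+Q+3*k-1)*(A+B+2*k-1))) =
    C (a + q) (b + q) (Suc q)"
    unfolding 2 H_def by (simp add: mult_ac)
  also have "H * ((B+2*k-1)*(A+B+k)/((B+k)*(A+B+2*k-1))) = - a2 l a b * G"
    unfolding 5 H_def by (simp add: mult_ac)
  also have "H * ((A+Q+2*k-1)*(B+2*k-1)*A*(A+B+Q+2*k)/((A+Q+k)*(B+k)*(A+k-1)*(A+B+Q+3*k-1))) =
    a1 l b * (a1 l (a + q) * C (a + q - 1) (b + q) q)"
    unfolding 3 4 H_def by (simp add: mult_ac)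
  also have "G = C (a + q) (b + q) q" by (simp add: G_def C_def d)
  finally show ?thesis by (simp add: mult_ac)
qed

lemma pieri_closed_rec:
  fixes k :: real and m n p :: nat
  defines "l \<equiv> 3 * k + 1"
  defines "C \<equiv> \<lambda>m n. pieri_closed k (real m) (real n)"
  assumes g: "generic l"
  shows "C (Suc m) n (Suc p) = C m n (Suc p) - a2 l (m - p) (n - p) * C m n p
      - a1 l m * a1 l (n - p) * C (m - 1) n p"
proof (cases "p \<le> m \<and> p < n")
  case True
  then show ?thesis
    using pieri_closed_rec_aux[of k "n - p" "m - p" p] g by (simp add: C_def l_def Suc_le_eq)
next
  case False
  \<comment> \<open>Outside the interior range every term is 0: the closed form vanishes beyond its
    range, and for \<open>n = p\<close> so do \<open>a1 l (n - p)\<close> and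
    \<open>a2 l (m - p) (n - p)\<close>.\<close>
  then consider "m < p" | "n < p" | "n = p" by linarith
  then show ?thesis
    unfolding C_def by cases (simp_all add: pieri_closed_eq_0 less_imp_diff_less del: of_nat_Suc)
qed

lemma pieri_eq_closed:
  assumes "generic (3 * k + 1)"
  shows "pieri (3 * k + 1) m n p = pieri_closed k (real m) (real n) p"
  using assms
proof (induction "3 * k + 1" m n p rule: pieri.induct)
  case (2 n p)
  then show ?case using pieri_closed_eq_0[of 0 "Suc p" n k] by simp
next
  case (3 m n p)
  then show ?case using pieri_closed_rec[of k m n p] by (simp del: of_nat_Suc)
qed simp

section \<open>The cancellation relation\<close>

lemma pieri_closed_cancel_aux:
  fixes k :: real and a b q :: nat
  defines "l \<equiv> 3 * k + 1"
  defines "C \<equiv> \<lambda>m n. pieri_closed k (real m) (real n)"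
  assumes g: "generic l" and a: "a > 0"
  shows "a1 l a * C (a + q + 1) (b + q) (Suc q) = a1 l (a + q + 1) * (C (a + q) (b + q) (Suc q)
      - a2 l b a * C (a + q) (b + q) q + a2 l 0 (a + q) * C (a + q - 1) (b + q) q)"
proof -
  note g = g[unfolded l_def]
  define A B Q where "A = real a" "B = real b" "Q = real q"
  note d = A_B_Q_def
  note numeral_distribs [simp del]
  have nz: "A + k \<noteq> 0" "B + k - 1 \<noteq> 0" "Q + 1 \<noteq> 0" "A + Q + k + 1 \<noteq> 0" "A + B + Q + 3 * k - 1 \<noteq> 0"
    "A + B + 2 * k - 1 \<noteq> 0" "A + Q + 2 * k \<noteq> 0"
    "A + Q + k \<noteq> 0" "A + k - 1 \<noteq> 0" "A + B + Q + 2 * k \<noteq> 0" "A + Q + k - 1 \<noteq> 0" "A + Q \<noteq> 0"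
    "A + Q + 2 * k - 1 \<noteq> 0"
    using generic_k_nz(1)[OF g, of a] generic_k_nz(2)[OF g, of b] generic_k_nz(1)[OF g, of "a + q + 1"]
      generic_k_nz(5)[OF g, of "a + b + q"] generic_k_nz(4)[OF g, of "a + b"]
      generic_k_nz(3)[OF g, of "a + q"] generic_k_nz(1)[OF g, of "a + q"] generic_k_nz(2)[OF g, of a]
      generic_k_nz(3)[OF g, of "a + b + q"] generic_k_nz(2)[OF g, of "a + q"]
      generic_k_nz(4)[OF g, of "a + q"] a
    by (auto simp: d)
  define G where "G = pieri_closed k (A + Q) (B + Q) q"
  have 1: "C (a + q + 1) (b + q) (Suc q) = G *
     ((k + Q) * (A + Q + 1) * B * (A + B + 3 * k - 1) /
      ((Q + 1) * (A + Q + k) * (B + k - 1) * (A + B + 2 * k) * 9))"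
    using pieri_closed_shift(1)[where a = A and b = B and p = q and k = k] by (simp add: C_def G_def d add_ac)
  have 2: "C (a + q) (b + q) (Suc q) = G *
     ((k + Q) * A * B * (A + B + 3 * k - 2) * (A + B + 3 * k - 1) * (A + B + Q + 2 * k) /
      ((Q + 1) * (A + k - 1) * (B + k - 1) * (A + B + Q + 3 * k - 1) *
       (A + B + 2 * k - 1) * (A + B + 2 * k) * 9))"
    using pieri_closed_shift(2)[where a = A and b = B and p = q and k = k] nz by (simp add: C_def G_def d)
  have 3: "a2 l 0 (a + q) * C (a + q - 1) (b + q) q =
     - G * ((A + Q + 3 * k - 1) / (9 * (A + Q + 2 * k))) *
     (A * (A + B + 3 * k - 1) * (A + B + Q + 2 * k) /
      ((A + k - 1) * (A + B + Q + 3 * k - 1) * (A + B + 2 * k)))"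
  proof -
    \<comment> \<open>With first index 0, \<open>A + Q + k\<close> and
      \<open>A + Q + 2 * k - 1\<close> occur both above and below; the remaining factors
      \<open>A + Q\<close> and \<open>A + Q + k - 1\<close> cancel against the shift.\<close>
    have a2: "a2 l 0 (a + q) = - ((A + Q) * (A + Q + 2 * k - 1) * (A + Q + k) * (A + Q + 3 * k - 1)) /
      (9 * (A + Q + k) * (A + Q + k - 1) * (A + Q + 2 * k - 1) * (A + Q + 2 * k))"
      unfolding l_def a2_generic[OF g] by (simp add: d)
    have "C (a + q - 1) (b + q) q = pieri_closed k (A + Q - 1) (B + Q) q"
      using a by (simp add: C_def d of_nat_diff Suc_leI)
    also have "\<dots> = G * (A * (A + Q + k - 1) * (A + B + 3 * k - 1) * (A + B + Q + 2 * k) /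
        ((A + Q) * (A + k - 1) * (A + B + Q + 3 * k - 1) * (A + B + 2 * k)))"
      using pieri_closed_shift(3)[where a = A and b = B and p = q and k = k] nz unfolding G_def d by blast
    finally show ?thesis
      unfolding a2 using nz by (simp add: mult_ac)
  qed
  have 4: "a1 l a = - (A * (A + 2 * k - 1)) / (3 * (A + k) * (A + k - 1))"
    unfolding l_def a1_generic[OF g] by (simp add: d)
  have 5: "a1 l (a + q + 1) = - ((A + Q + 1) * (A + Q + 2 * k)) / (3 * (A + Q + k + 1) * (A + Q + k))"
    unfolding l_def a1_generic[OF g] by (simp add: d add_ac)
  have 6: "a2 l b a = - (A * (A + 2 * k - 1) * (A + B + k) * (A + B + 3 * k - 1)) /
      (9 * (A + k) * (A + k - 1) * (A + B + 2 * k - 1) * (A + B + 2 * k))"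
    unfolding l_def a2_generic[OF g] by (simp add: d add_ac)
  \<comment> \<open>Both sides share the factor \<open>- h * H\<close>: \<open>H\<close> is common
    to the terms in the bracket, and \<open>h\<close> is the part of
    \<open>- a1 l (a + q + 1)\<close> that \<open>pieri_cancel_identity\<close> leaves out.\<close>
  define H where "H = G * A * (A + B + 3 * k - 1) / (9 * (A + k - 1) * (A + B + 2 * k))"
  define h where "h = (A + Q + 1) / (3 * (A + Q + k))"
  have "a1 l a * C (a + q + 1) (b + q) (Suc q) = - h * H * ((A+2*k-1)*B*(k+Q)/((A+k)*(B+k-1)*(Q+1)))"
    unfolding 1 4 H_def h_def by (simp add: mult_ac)
  also have "\<dots> = - (h * ((A+Q+2*k)/(A+Q+k+1))) *
     (H * ((k+Q)*B*(A+B+3*k-2)*(A+B+Q+2*k)/((Q+1)*(B+k-1)*(A+B+Q+3*k-1)*(A+B+2*k-1)))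
      + H * ((A+2*k-1)*(A+B+k)/((A+k)*(A+B+2*k-1)))
      - H * ((A+Q+3*k-1)*(A+B+Q+2*k)/((A+Q+2*k)*(A+B+Q+3*k-1))))"
  proof -
    have "- h * H * (f * (u + v - w)) = - (h * f) * (H * u + H * v - H * w)" for f u v w
      by (simp add: algebra_simps)
    then show ?thesis unfolding pieri_cancel_identity[OF nz(1-7)] .
  qed
  also have "- (h * ((A+Q+2*k)/(A+Q+k+1))) = a1 l (a + q + 1)"
    unfolding 5 h_def by (simp add: mult_ac)
  also have "H * ((k+Q)*B*(A+B+3*k-2)*(A+B+Q+2*k)/((Q+1)*(B+k-1)*(A+B+Q+3*k-1)*(A+B+2*k-1))) =
    C (a + q) (b + q) (Suc q)"
    unfolding 2 H_def by (simp add: mult_ac)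
  also have "H * ((A+2*k-1)*(A+B+k)/((A+k)*(A+B+2*k-1))) = - a2 l b a * G"
    unfolding 6 H_def by (simp add: mult_ac)
  also have "H * ((A+Q+3*k-1)*(A+B+Q+2*k)/((A+Q+2*k)*(A+B+Q+3*k-1))) =
    - a2 l 0 (a + q) * C (a + q - 1) (b + q) q"
    unfolding mult_minus_left 3 H_def by (simp add: mult_ac)
  also have "G = C (a + q) (b + q) q" by (simp add: G_def C_def d)
  finally show ?thesis by simp
qed

text \<open>This makes the coefficient of \<open>P (m - 1 - p) (n - p)\<close> in the expansion of
  \<open>P (m + 2) 0 * P 0 n\<close> vanish: the left side comes from multiplication by
  \<open>Zv\<close>, the right side mostly from \<open>Zbarv\<close>.\<close>

lemma pieri_closed_cancel:
  fixes k :: real and m n p :: nat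
  defines "l \<equiv> 3 * k + 1"
  defines "C \<equiv> \<lambda>m n. pieri_closed k (real m) (real n)"
  assumes g: "generic l"
  shows "a1 l (m - p) * C (Suc m) n (Suc p) = a1 l (Suc m) * (C m n (Suc p)
      - a2 l (n - p) (m - p) * C m n p + a2 l 0 m * C (m - 1) n p)"
proof (cases "p < m \<and> p \<le> n")
  case True
  then show ?thesis
    using pieri_closed_cancel_aux[of k "m - p" p "n - p"] g by (simp add: C_def l_def)
next
  case False
  then consider "m < p" | "n < p" | "m = p" by linarith
  then show ?thesis
  proof cases
    \<comment> \<open>Here \<open>a1 l (m - p)\<close> and \<open>a2 l (n - p) (m - p)\<close> are
      0. The last term vanishes since \<open>m - 1 < p\<close> if \<open>p > 0\<close>, and since
      \<open>a2 l 0 0 = 0\<close> if \<open>p = 0\<close>.\<close>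
    case 3
    have "C m n (Suc p) = 0" "p > 0 \<Longrightarrow> C (m - 1) n p = 0"
      unfolding C_def using 3 by (intro pieri_closed_eq_0; simp)+
    then show ?thesis using 3 by (cases "p = 0") simp_all
  qed (simp_all add: C_def pieri_closed_eq_0 less_imp_diff_less del: of_nat_Suc)
qed

text \<open>The limit is taken for \<open>pieri\<close>, which is continuous at every positive
  \<open>l\<close>; denominators of \<open>pieri_closed\<close> can vanish at exceptional values
  such as \<open>k = 0\<close>.\<close>

lemma pieri_cancel:
  assumes "l > 0"
  shows "a1 l (m - p) * pieri l (Suc m) n (Suc p) = a1 l (Suc m) * (pieri l m n (Suc p)
      - a2 l (n - p) (m - p) * pieri l m n p + a2 l 0 m * pieri l (m - 1) n p)"
proof -
  have "a1 l (m - p) * pieri l (Suc m) n (Suc p) - a1 l (Suc m) * (pieri l m n (Suc p)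
      - a2 l (n - p) (m - p) * pieri l m n p + a2 l 0 m * pieri l (m - 1) n p) = 0"
  proof (rule extend_by_continuity[OF assms])
    fix x assume x: "generic x"
    define k where "k = (x - 1) / 3"
    have "x = 3 * k + 1" by (simp add: k_def field_simps)
    then show "a1 x (m - p) * pieri x (Suc m) n (Suc p) - a1 x (Suc m) * (pieri x m n (Suc p)
      - a2 x (n - p) (m - p) * pieri x m n p + a2 x 0 m * pieri x (m - 1) n p) = 0"
      using x pieri_closed_cancel[of k m p n] 
      by (simp only: pieri_eq_closed)
  qed (intro tendsto_intros a1_tendsto a2_tendsto pieri_tendsto assms)
  then show ?thesis by simp
qed

subsection \<open>The Pieri formula\<close>

lemma cst_1: "cst 1 = 1" and cst_minus: "cst (- x) = - cst x"
  by (simp_all add: cst_def one_pCons)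

text \<open>The second recurrence eliminates \<open>P (m - 1) 1\<close>, so that only products with
  second index 0 remain and an induction on \<open>m\<close> can run. Truncation at
  \<open>m = 0\<close> and \<open>m = 1\<close> is harmless, as \<open>a1\<close> and
  \<open>a2\<close> are 0 there.\<close>

lemma single_index_product_rec:
  assumes "lam \<alpha> > 0"
  shows "P \<alpha> (Suc m) 0 * X = Zv * (P \<alpha> m 0 * X) + cst (a1 (lam \<alpha>) m) *
     (Zbarv * (P \<alpha> (m - 1) 0 * X) + cst (a2 (lam \<alpha>) 0 (m - 1)) * (P \<alpha> (m - 2) 0 * X))"
proof -
  have "P \<alpha> (Suc m) 0 = Zv * P \<alpha> m 0 + cst (a1 (lam \<alpha>) m) * P \<alpha> (m - 1) 1"
    using P_rec1[of \<alpha> m 0] by (simp add: cst_simps)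
  moreover have "P \<alpha> (m - 1) 1 = Zbarv * P \<alpha> (m - 1) 0 + cst (a2 (lam \<alpha>) 0 (m - 1)) * P \<alpha> (m - 2) 0"
    using P_rec2[OF assms, of "m - 1" 0] by (simp add: cst_simps numeral_2_eq_2 del: P.simps)
  ultimately show ?thesis by (simp add: algebra_simps)
qed

text \<open>The bound \<open>N\<close> is any number above \<open>m\<close>, which gives the three
  products of the induction step a common range of summation; the surplus coefficients are
  0.\<close>

lemma pieri_product:
  assumes "lam \<alpha> > 0" "m < N"
  shows "P \<alpha> m 0 * P \<alpha> 0 n = (\<Sum>p<N. cst (pieri (lam \<alpha>) m n p) * P \<alpha> (m - p) (n - p))"
  using assms(2)
proof (induction m rule: less_induct)
  case (less m')
  define l where "l = lam \<alpha>"
  have l: "l > 0" using assms by (simp add: l_def)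
  show ?case
  proof (cases m')
    case 0
    have "(\<Sum>p<N. cst (pieri l 0 n p) * P \<alpha> (0 - p) (n - p)) =
      (\<Sum>p<N. if p = 0 then P \<alpha> 0 n else 0)"
      by (intro sum.cong refl) (auto simp: pieri_eq_0 cst_simps cst_1)
    then show ?thesis using 0 less.prems by (simp add: l_def)
  next
    case (Suc m)
    obtain K where K: "N = Suc K" "m < K" using less.prems Suc by (cases N) auto
    define c where "c = (\<lambda>m p. cst (pieri l m n p))"
    define A1 where "A1 = (\<lambda>m. cst (a1 l m))"
    define A2 where "A2 = (\<lambda>p q. cst (a2 l p q))"
    have c0: "c i p = 0" if "i < p \<or> n < p" for i p
      using that by (simp add: c_def pieri_eq_0 cst_simps)
    have IH: "P \<alpha> i 0 * P \<alpha> 0 n = (\<Sum>p<N. c i p * P \<alpha> (i - p) (n - p))" if "i \<le> m" for i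
      using less.IH[of i] that Suc less.prems by (simp add: c_def l_def)
    \<comment> \<open>\<open>F\<close>, \<open>F'\<close> collect the terms that survive; \<open>G\<close>, \<open>G'\<close> those that cancel. The primed parts
       belong to index \<open>Suc p\<close>.\<close>
    define F where "F = (\<lambda>p. c m p * P \<alpha> (m + 1 - p) (n - p))"
    define F' where "F' = (\<lambda>p. (- A2 (m - p) (n - p) * c m p - A1 m * A1 (n - p) * c (m - 1) p) *
      P \<alpha> (m - p) (n - p - 1))"
    define G where "G = (\<lambda>p. (- A1 (m - p) * c m p + A1 m * c (m - 1) p) * P \<alpha> (m - 1 - p) (n + 1 - p))"
    define G' where "G' = (\<lambda>p. A1 m * (- A2 (n - p) (m - 1 - p) * c (m - 1) p + A2 0 (m - 1) * c (m - 2) p) *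
      P \<alpha> (m - 2 - p) (n - p))"
    have Z: "Zv * P \<alpha> a b = P \<alpha> (a + 1) b - A1 a * P \<alpha> (a - 1) (b + 1) - A2 a b * P \<alpha> a (b - 1)" for a b
      using P_rec1[of \<alpha> a b] unfolding l_def A1_def A2_def by algebra
    have Zb: "Zbarv * P \<alpha> a b = P \<alpha> a (b + 1) - A1 b * P \<alpha> (a + 1) (b - 1) - A2 b a * P \<alpha> (a - 1) b" for a b
      using P_rec2[OF assms(1), of a b] unfolding l_def A1_def A2_def by algebra
    have step: "Zv * (c m p * P \<alpha> (m - p) (n - p)) + A1 m *
       (Zbarv * (c (m - 1) p * P \<alpha> (m - 1 - p) (n - p)) + A2 0 (m - 1) * (c (m - 2) p * P \<alpha> (m - 2 - p) (n - p)))
       = (F p + F' p) + (G p + G' p)" for p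
    proof -
      have t1: "Zv * (c m p * P \<alpha> (m - p) (n - p)) = c m p * (P \<alpha> (m + 1 - p) (n - p)
        - A1 (m - p) * P \<alpha> (m - 1 - p) (n + 1 - p) - A2 (m - p) (n - p) * P \<alpha> (m - p) (n - p - 1))"
      \<comment> \<open>Out of this range the truncated indices no longer match the recurrence, but
        then \<open>c m p = 0\<close>.\<close>
      proof (cases "p \<le> m \<and> p \<le> n")
        case True
        then have "Zv * P \<alpha> (m - p) (n - p) = P \<alpha> (m + 1 - p) (n - p)
          - A1 (m - p) * P \<alpha> (m - 1 - p) (n + 1 - p) - A2 (m - p) (n - p) * P \<alpha> (m - p) (n - p - 1)"
          using Z[of "m - p" "n - p"] by (simp add: Suc_diff_le del: P.simps)
        then show ?thesis by algebra
      qed (use c0[of m p] in auto)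
      have t2: "A1 m * (Zbarv * (c (m - 1) p * P \<alpha> (m - 1 - p) (n - p))) = A1 m * (c (m - 1) p *
        (P \<alpha> (m - 1 - p) (n + 1 - p) - A1 (n - p) * P \<alpha> (m - p) (n - p - 1)
         - A2 (n - p) (m - 1 - p) * P \<alpha> (m - 2 - p) (n - p)))"
      proof (cases "m > 0 \<and> p \<le> m - 1 \<and> p \<le> n")
        case True
        then have "m - 1 - p + 1 = m - p" "m - 1 - p - 1 = m - 2 - p" "n - p + 1 = n + 1 - p" by auto
        then have "Zbarv * P \<alpha> (m - 1 - p) (n - p) = P \<alpha> (m - 1 - p) (n + 1 - p)
          - A1 (n - p) * P \<alpha> (m - p) (n - p - 1) - A2 (n - p) (m - 1 - p) * P \<alpha> (m - 2 - p) (n - p)"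
          using Zb[of "m - 1 - p" "n - p"] by (simp del: P.simps)
        then show ?thesis by algebra
      next
        case False
        then have "A1 m = 0 \<or> c (m - 1) p = 0"
          using c0[of "m - 1" p] by (auto simp: A1_def cst_simps)
        then show ?thesis by auto
      qed
      show ?thesis
        unfolding F_def F'_def G_def G'_def distrib_left[of "A1 m"] t1 t2 by algebra
    qed
    have FF': "F (Suc p) + F' p = c (Suc m) (Suc p) * P \<alpha> (Suc m - Suc p) (n - Suc p)" for p
    proof -
      have "c (Suc m) (Suc p) = c m (Suc p) - A2 (m - p) (n - p) * c m p - A1 m * A1 (n - p) * c (m - 1) p"
        by (simp add: c_def A1_def A2_def cst_simps)
      moreover have "F (Suc p) = c m (Suc p) * P \<alpha> (m - p) (n - p - 1)"
        by (simp add: F_def del: P.simps)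
      moreover have "P \<alpha> (Suc m - Suc p) (n - Suc p) = P \<alpha> (m - p) (n - p - 1)"
        by (simp del: P.simps)
      ultimately show ?thesis unfolding F'_def by algebra
    qed
    have GG': "G (Suc p) + G' p = 0" for p
    \<comment> \<open>For \<open>m = Suc i\<close> this is \<open>pieri_cancel\<close> at
      \<open>i\<close>, times one polynomial \<open>P\<close>; for \<open>m = 0\<close> all
      coefficients vanish.\<close>
    proof (cases m)
      case 0
      then show ?thesis using c0[of 0 "Suc p"] by (simp add: G_def G'_def A1_def cst_simps)
    next
      case (Suc i)
      have "A1 (i - p) * c (Suc i) (Suc p) = A1 (Suc i) * (c i (Suc p)
         - A2 (n - p) (i - p) * c i p + A2 0 i * c (i - 1) p)"
        using arg_cong[OF pieri_cancel[OF l, of i p n], of cst]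
        unfolding c_def A1_def A2_def cst_simps .
      moreover have "G (Suc p) = (- A1 (i - p) * c (Suc i) (Suc p) + A1 (Suc i) * c i (Suc p)) * P \<alpha> (i - 1 - p) (n - p)"
        by (simp add: G_def Suc del: P.simps)
      moreover have "G' p = A1 (Suc i) * (- A2 (n - p) (i - p) * c i p + A2 0 i * c (i - 1) p) * P \<alpha> (i - 1 - p) (n - p)"
        by (simp add: G'_def Suc numeral_2_eq_2 del: P.simps)
      ultimately show ?thesis by algebra
    qed
    \<comment> \<open>The two contributions cancel because \<open>c m 0\<close> and
      \<open>c (m - 1) 0\<close> are both 1.\<close>
    have G0: "G 0 = 0" by (simp add: G_def c_def)
    \<comment> \<open>As \<open>m < K\<close>, the final primed terms vanish, which permits pairing
      index \<open>Suc p\<close> of \<open>F\<close>, \<open>G\<close> with index \<open>p\<close>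
      of \<open>F'\<close>, \<open>G'\<close>.\<close>
    have last: "F' K = 0" "G' K = 0" using c0[of m K] c0[of "m - 1" K] c0[of "m - 2" K] K(2)
      by (simp_all add: F'_def G'_def less_imp_diff_less)
    have "P \<alpha> m' 0 * P \<alpha> 0 n = Zv * (P \<alpha> m 0 * P \<alpha> 0 n) + A1 m *
     (Zbarv * (P \<alpha> (m - 1) 0 * P \<alpha> 0 n) + A2 0 (m - 1) * (P \<alpha> (m - 2) 0 * P \<alpha> 0 n))"
      using single_index_product_rec[OF assms(1)] unfolding Suc A1_def A2_def l_def by blast
    also have "\<dots> = (\<Sum>p<N. (F p + F' p) + (G p + G' p))"
      unfolding step[symmetric] IH[OF order_refl] IH[OF diff_le_self]
      by (simp only: sum_distrib_left sum.distrib distrib_left)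
    also have "\<dots> = (\<Sum>p<N. F p + F' p) + (\<Sum>p<N. G p + G' p)"
      by (rule sum.distrib)
    also have "(\<Sum>p<N. G p + G' p) = (\<Sum>p<K. G (Suc p) + G' p)"
      unfolding K sum.distrib sum.lessThan_Suc_shift[of G] sum.lessThan_Suc[of G'] by (simp add: G0 last)
    also have "\<dots> = 0" by (simp add: GG')
    also have "(\<Sum>p<N. F p + F' p) = F 0 + (\<Sum>p<K. F (Suc p) + F' p)"
      unfolding K sum.distrib sum.lessThan_Suc_shift[of F] sum.lessThan_Suc[of F'] by (simp add: last)
    also have "\<dots> = (\<Sum>p<N. c (Suc m) p * P \<alpha> (Suc m - p) (n - p))"
      unfolding FF' K sum.lessThan_Suc_shift by (simp add: F_def c_def)
    finally show ?thesis by (simp add: Suc c_def l_def)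
  qed
qed

subsection \<open>Inverting the Pieri formula\<close>

text \<open>The real span of the admissible products, shaped so that membership of
  \<open>P \<alpha> m n\<close> is literally the claim.\<close>

definition product_span :: "real \<Rightarrow> nat \<Rightarrow> nat \<Rightarrow> real poly poly set" where
  "product_span \<alpha> m n =
     {X. \<exists>d. X = (\<Sum>p = 0..min m n. cst (d p) * P \<alpha> (m - p) 0 * P \<alpha> 0 (n - p))}"

lemma product_span_base: "P \<alpha> m 0 * P \<alpha> 0 n \<in> product_span \<alpha> m n"
proof -
  have "P \<alpha> m 0 * P \<alpha> 0 n = (\<Sum>p = 0..min m n. if p = 0 then P \<alpha> m 0 * P \<alpha> 0 n else 0)"
    by simp
  also have "\<dots> = (\<Sum>p = 0..min m n. cst (if p = 0 then 1 else 0) * P \<alpha> (m - p) 0 * P \<alpha> 0 (n - p))"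
    by (intro sum.cong) (auto simp: cst_simps cst_1)
  finally show ?thesis unfolding product_span_def by (intro CollectI exI)
qed

lemma product_span_add:
  assumes "X \<in> product_span \<alpha> m n" "Y \<in> product_span \<alpha> m n"
  shows "X + Y \<in> product_span \<alpha> m n"
proof -
  obtain d e where "X = (\<Sum>p = 0..min m n. cst (d p) * P \<alpha> (m - p) 0 * P \<alpha> 0 (n - p))"
    "Y = (\<Sum>p = 0..min m n. cst (e p) * P \<alpha> (m - p) 0 * P \<alpha> 0 (n - p))"
    using assms unfolding product_span_def by blast
  then have "X + Y = (\<Sum>p = 0..min m n. cst (d p + e p) * P \<alpha> (m - p) 0 * P \<alpha> 0 (n - p))"
    by (simp add: cst_simps distrib_right sum.distrib)
  then show ?thesis unfolding product_span_def by (intro CollectI exI)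
qed

lemma product_span_cst_mult:
  assumes "X \<in> product_span \<alpha> m n"
  shows "cst c * X \<in> product_span \<alpha> m n"
proof -
  obtain d where "X = (\<Sum>p = 0..min m n. cst (d p) * P \<alpha> (m - p) 0 * P \<alpha> 0 (n - p))"
    using assms unfolding product_span_def by blast
  then have "cst c * X = (\<Sum>p = 0..min m n. cst (c * d p) * P \<alpha> (m - p) 0 * P \<alpha> 0 (n - p))"
    by (simp add: cst_simps sum_distrib_left mult_ac)
  then show ?thesis unfolding product_span_def by (intro CollectI exI)
qed

lemma product_span_sum:
  assumes "\<And>i. i \<in> I \<Longrightarrow> X i \<in> product_span \<alpha> m n"
  shows "sum X I \<in> product_span \<alpha> m n"
proof -
  have "0 \<in> product_span \<alpha> m n"
    using product_span_cst_mult[OF product_span_base, of 0] by (simp add: cst_simps)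
  then show ?thesis
    using assms by (induction I rule: infinite_finite_induct) (auto intro: product_span_add)
qed

text \<open>The product of index \<open>i\<close> for \<open>(m - p, n - p)\<close> is the product
  of index \<open>p + i\<close> for \<open>(m, n)\<close>.\<close>

lemma product_span_shift:
  assumes "p \<le> m" "p \<le> n"
  shows "product_span \<alpha> (m - p) (n - p) \<subseteq> product_span \<alpha> m n"
proof
  fix X assume "X \<in> product_span \<alpha> (m - p) (n - p)"
  then obtain d where X: "X = (\<Sum>i = 0..min (m - p) (n - p).
      cst (d i) * P \<alpha> (m - p - i) 0 * P \<alpha> 0 (n - p - i))"
    unfolding product_span_def by blast
  have "cst (d i) * P \<alpha> (m - p - i) 0 * P \<alpha> 0 (n - p - i) \<in> product_span \<alpha> m n"
    if i: "i \<in> {0..min (m - p) (n - p)}" for i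
  proof -
    have "cst (d i) * P \<alpha> (m - p - i) 0 * P \<alpha> 0 (n - p - i) =
      (\<Sum>j = 0..min m n. if j = p + i then cst (d i) * P \<alpha> (m - j) 0 * P \<alpha> 0 (n - j) else 0)"
      using i assms by (simp add: le_diff_conv2)
    also have "\<dots> = (\<Sum>j = 0..min m n. cst (if j = p + i then d i else 0) * P \<alpha> (m - j) 0 * P \<alpha> 0 (n - j))"
      by (intro sum.cong) (auto simp: cst_simps)
    finally show ?thesis unfolding product_span_def by (intro CollectI exI)
  qed
  then show "X \<in> product_span \<alpha> m n" unfolding X by (rule product_span_sum)
qed

text \<open>The Pieri formula has coefficient 1 at \<open>p = 0\<close> and can be solved for
  \<open>P \<alpha> m n\<close>; the other terms have a smaller first index and lie in smaller spans
  by induction.\<close>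

lemma P_in_product_span:
  assumes "lam \<alpha> > 0"
  shows "P \<alpha> m n \<in> product_span \<alpha> m n"
proof (induction m arbitrary: n rule: less_induct)
  case (less m)
  define T where "T = (\<lambda>p. cst (pieri (lam \<alpha>) m n p) * P \<alpha> (m - p) (n - p))"
  have "P \<alpha> m 0 * P \<alpha> 0 n = (\<Sum>p<Suc m. T p)"
    using pieri_product[OF assms, of m "Suc m" n] by (simp add: T_def)
  also have "\<dots> = P \<alpha> m n + (\<Sum>p<m. T (Suc p))"
    unfolding sum.lessThan_Suc_shift by (simp add: T_def cst_1)
  finally have "P \<alpha> m n = P \<alpha> m 0 * P \<alpha> 0 n + cst (- 1) * (\<Sum>p<m. T (Suc p))"
    by (simp add: cst_minus cst_1)
  moreover have "T (Suc p) \<in> product_span \<alpha> m n" if "p < m" for p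
  proof (cases "Suc p \<le> n")
    case True
    then have "P \<alpha> (m - Suc p) (n - Suc p) \<in> product_span \<alpha> m n"
      using less.IH[of "m - Suc p" "n - Suc p"] product_span_shift[of "Suc p" m n \<alpha>] that by auto
    then show ?thesis unfolding T_def by (rule product_span_cst_mult)
  next
    case False
    \<comment> \<open>Here \<open>n - Suc p\<close> is truncated, but the Pieri coefficient is
      0.\<close>
    then have "T (Suc p) = cst 0 * (P \<alpha> m 0 * P \<alpha> 0 n)" by (simp add: T_def pieri_eq_0 cst_simps)
    then show ?thesis using product_span_cst_mult[OF product_span_base] by simp
  qed
  ultimately show ?case
    by (auto intro!: product_span_add product_span_base product_span_cst_mult product_span_sum)
qed

theorem mainTheorem7:
  fixes \<alpha> :: real and m n :: nat
  assumes "\<alpha> > - 5 / 6"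
  shows "\<exists>d :: nat \<Rightarrow> real.
    P \<alpha> m n = (\<Sum>p = 0..min m n. cst (d p) * P \<alpha> (m - p) 0 * P \<alpha> 0 (n - p))"
proof -
  have "lam \<alpha> > 0" using assms by (simp add: lam_def)
  then show ?thesis using P_in_product_span[of \<alpha> m n] unfolding product_span_def by blast
qed

end
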